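(* Let $n\ge 1$ be an integer and let $p_1,\dots,p_n>0$ be real numbers with $\sum_{i=1}^n p_i=1$. Let $C_1,C_2,\dots$ be independent random variables with values in $\{1,\dots,n\}$ such that $P(C_t=i)=p_i$ for all $t\ge1$ and $1\le i\le n$. Let $N$ be the number of draws needed to complete the collection, $N=\min\{t\ge 1 : \{C_1,\dots,C_t\}=\{1,\dots,n\}\}$. Then $$E(N)= \sum_{j}\frac{1}{p_j} - \sum_{i<j}\frac{1}{p_i+p_j} + \dots +(-1)^{n-1} \frac{1}{p_1+\dots+p_n},$$ that is, $$E(N)=\sum_{\emptyset\ne S\subseteq\{1,\dots,n\}} (-1)^{|S|-1}\,\frac{1}{\sum_{i\in S}p_i}.$$
   Context: Coupon collector's problem with unequal probabilities: there are $n$ coupon types; $C_t$ denotes the type of the coupon obtained at the $t$-th purchase, and $N$ is the number of coupons purchased until at least one coupon of each type has been obtained. $E$ denotes expectation. *)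

theory Defs
  imports "HOL-Probability.Probability"
begin

text \<open>
  Draws are indexed from 1. The value lies in \<^typ>\<open>enat\<close>: on the outcomes for which the
  collection is never completed, the infimum of the empty set gives \<open>\<infinity>\<close>.
\<close>

definition collection_time :: "nat \<Rightarrow> (nat \<Rightarrow> 'a \<Rightarrow> nat) \<Rightarrow> 'a \<Rightarrow> enat" where
  "collection_time n C \<omega> =
     Inf {enat t | t. 1 \<le> t \<and> (\<lambda>s. C s \<omega>) ` {1..t} = {1..n}}"

text \<open>
  The expectation of a random variable that may be infinite is its nonnegative Lebesgue integral.
  It is embedded into \<^typ>\<open>ereal\<close> so that it can be compared with a real number given by an
  alternating sum, without truncating that number at 0.
\<close>

definition expectation_enat :: "'a measure \<Rightarrow> ('a \<Rightarrow> enat) \<Rightarrow> ereal" where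
  "expectation_enat M X = enn2ereal (\<integral>\<^sup>+ \<omega>. ennreal_of_enat (X \<omega>) \<partial>M)"

end

theory Submission
  imports Defs
begin

text \<open>
  Since \<open>N\<close> takes values in the extended naturals, \<open>E(N) = (\<Sum>t. P(N > t))\<close>. The event \<open>N > t\<close>
  says that some coupon type is missing among the first \<open>t\<close> draws, and all the types of a set \<open>S\<close>
  are missing with probability \<open>(1 - p(S))^t\<close>. Inclusion-exclusion writes \<open>P(N > t)\<close> as an
  alternating sum of these powers, and summing the geometric series over \<open>t\<close> turns each of them
  into \<open>1 / p(S)\<close>.
\<close>

text \<open>Draws never leave \<open>{1..n}\<close>, so the image of the first \<open>t\<close>
  draws differs from \<open>{1..n}\<close> only by lacking some type. A type absent up to time
  \<open>t\<close> is also absent at every earlier time, which bounds the infimum from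
  below.\<close>

lemma less_collection_time_iff:
  assumes "n \<ge> 1" and C: "\<And>s. s \<ge> 1 \<Longrightarrow> C s \<omega> \<in> {1..n}"
  shows "enat t < collection_time n C \<omega> \<longleftrightarrow> (\<exists>i\<in>{1..n}. \<forall>s\<in>{1..t}. C s \<omega> \<noteq> i)"
proof
  assume less: "enat t < collection_time n C \<omega>"
  have "(\<lambda>s. C s \<omega>) ` {1..t} \<noteq> {1..n}"
  proof
    \<comment> \<open>At \<open>t = 0\<close> the image is empty, hence different from
      \<open>{1..n}\<close> because \<open>n \<ge> 1\<close>. So \<open>eq\<close> forces
      \<open>1 \<le> t\<close>, and \<open>t\<close> belongs to the set whose infimum is
      taken.\<close>
    assume eq: "(\<lambda>s. C s \<omega>) ` {1..t} = {1..n}"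
    with \<open>n \<ge> 1\<close> have "1 \<le> t"
      by (cases t) auto
    with eq have "collection_time n C \<omega> \<le> enat t"
      unfolding collection_time_def by (intro Inf_lower) auto
    with less show False
      by simp
  qed
  moreover have "(\<lambda>s. C s \<omega>) ` {1..t} \<subseteq> {1..n}"
    using C by force
  ultimately obtain i where i: "i \<in> {1..n}" "i \<notin> (\<lambda>s. C s \<omega>) ` {1..t}"
    by (meson subset_antisym subsetI)
  from i(2) have "\<forall>s\<in>{1..t}. C s \<omega> \<noteq> i"
    by (metis imageI)
  with i(1) show "\<exists>i\<in>{1..n}. \<forall>s\<in>{1..t}. C s \<omega> \<noteq> i"
    by (rule bexI[rotated])
next
  assume "\<exists>i\<in>{1..n}. \<forall>s\<in>{1..t}. C s \<omega> \<noteq> i"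
  then obtain i where i: "i \<in> {1..n}" "\<And>s. s \<in> {1..t} \<Longrightarrow> C s \<omega> \<noteq> i"
    by blast
  have "enat (Suc t) \<le> collection_time n C \<omega>"
    unfolding collection_time_def
  proof (intro Inf_greatest, safe)
    fix u assume "1 \<le> u" and eq: "(\<lambda>s. C s \<omega>) ` {1..u} = {1..n}"
    \<comment> \<open>A time \<open>u\<close> that completes the collection must include a draw of
      the missing type \<open>i\<close>, and that draw comes after time \<open>t\<close>.\<close>
    then obtain s where "s \<in> {1..u}" "C s \<omega> = i"
      using i(1) by (metis (no_types, lifting) imageE)
    with i(2)[of s] show "enat (Suc t) \<le> enat u"
      by (cases "s \<le> t") auto
  qed
  then show "enat t < collection_time n C \<omega>"
    by (simp add: Suc_ile_eq)
qed

text \<open>The set under the infimum depends on the outcome. Giving each unsuitable time the value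
  \<open>\<infinity>\<close> turns the infimum into one over the fixed countable family
  \<open>X t\<close>, each member of which is measurable.\<close>

lemma measurable_collection_time:
  assumes C: "\<And>s. s \<ge> 1 \<Longrightarrow> C s \<in> measurable M (count_space {1..n})"
  shows "collection_time n C \<in> measurable M (count_space UNIV)"
proof -
  define X where
    "X t \<omega> = (if 1 \<le> t \<and> (\<lambda>s. C s \<omega>) ` {1..t} = {1..n} then enat t else \<infinity>)" for t \<omega>
  have "(\<lambda>\<omega>. (\<lambda>s. C s \<omega>) ` {1..t} = {1..n}) \<in> measurable M (count_space UNIV)" for t
  proof -
    have [measurable]: "Measurable.pred M (\<lambda>\<omega>. C s \<omega> = i)" if "s \<ge> 1" for s i
      using measurable_compose[OF C[OF that], of "\<lambda>c. c = i" "count_space UNIV"]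
      by simp
    \<comment> \<open>Equality of image and range is spelled out as two inclusions with finite
      quantifiers over the basic events \<open>C s \<omega> = i\<close>.\<close>
    have "Measurable.pred M (\<lambda>\<omega>. (\<forall>s\<in>{1..t}. \<exists>i\<in>{1..n}. C s \<omega> = i) \<and>
            (\<forall>i\<in>{1..n}. \<exists>s\<in>{1..t}. C s \<omega> = i))"
      by (intro pred_intros_logic pred_intros_finite) auto
    also have "(\<lambda>\<omega>. (\<forall>s\<in>{1..t}. \<exists>i\<in>{1..n}. C s \<omega> = i) \<and> (\<forall>i\<in>{1..n}. \<exists>s\<in>{1..t}. C s \<omega> = i)) =
        (\<lambda>\<omega>. (\<lambda>s. C s \<omega>) ` {1..t} = {1..n})"
      by (intro ext) (simp only: set_eq_subset subset_iff image_iff ball_simps, metis)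
    finally show ?thesis .
  qed
  then have "X t \<in> measurable M (count_space UNIV)" for t
    unfolding X_def by measurable
  then have "(\<lambda>\<omega>. INF t. X t \<omega>) \<in> measurable M (count_space UNIV)"
    by (intro measurable_INF) auto
  also have "(\<lambda>\<omega>. INF t. X t \<omega>) = collection_time n C"
  proof
    fix \<omega>
    show "(INF t. X t \<omega>) = collection_time n C \<omega>"
      unfolding collection_time_def
    proof (rule antisym)
      show "(INF t. X t \<omega>) \<le> Inf {enat t |t. 1 \<le> t \<and> (\<lambda>s. C s \<omega>) ` {1..t} = {1..n}}"
      proof (intro Inf_greatest, safe)
        fix t assume "1 \<le> t" "(\<lambda>s. C s \<omega>) ` {1..t} = {1..n}"
        then have "X t \<omega> = enat t"
          by (simp add: X_def)
        then show "(INF t. X t \<omega>) \<le> enat t"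
          by (metis INF_lower UNIV_I)
      qed
      show "Inf {enat t |t. 1 \<le> t \<and> (\<lambda>s. C s \<omega>) ` {1..t} = {1..n}} \<le> (INF t. X t \<omega>)"
        by (intro INF_greatest) (auto simp: X_def intro!: Inf_lower)
    qed
  qed
  finally show ?thesis .
qed

locale coupon_collector = prob_space M for M :: "'a measure" +
  fixes n :: nat and p :: "nat \<Rightarrow> real" and C :: "nat \<Rightarrow> 'a \<Rightarrow> nat"
  assumes n_ge_1: "n \<ge> 1"
    and p_pos: "\<And>i. i \<in> {1..n} \<Longrightarrow> p i > 0"
    and p_sum: "(\<Sum>i=1..n. p i) = 1"
    and indep_draws: "indep_vars (\<lambda>_. count_space {1..n}) C {1..}"
    and prob_draw: "\<And>t i. t \<ge> 1 \<Longrightarrow> i \<in> {1..n} \<Longrightarrow> prob {\<omega> \<in> space M. C t \<omega> = i} = p i"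
begin

lemma measurable_draw: "t \<ge> 1 \<Longrightarrow> C t \<in> measurable M (count_space {1..n})"
  using indep_draws unfolding indep_vars_def by auto

lemma draw_in_range: "t \<ge> 1 \<Longrightarrow> \<omega> \<in> space M \<Longrightarrow> C t \<omega> \<in> {1..n}"
  using measurable_space[OF measurable_draw] by fastforce

lemma sets_draw: "t \<ge> 1 \<Longrightarrow> {\<omega> \<in> space M. C t \<omega> \<in> S} \<in> events"
proof -
  assume t: "t \<ge> 1"
  have "{\<omega> \<in> space M. C t \<omega> \<in> S} = C t -` (S \<inter> {1..n}) \<inter> space M"
    using draw_in_range[OF t] by auto
  then show ?thesis
    using measurable_sets[OF measurable_draw[OF t], of "S \<inter> {1..n}"] by simp
qed

text \<open>These bounds place the ratio \<open>1 - sum p S\<close> in \<open>[0, 1)\<close>, so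
  that its geometric series converges.\<close>

lemma p_sum_range:
  assumes "S \<subseteq> {1..n}" "S \<noteq> {}"
  shows "0 < sum p S" "sum p S \<le> 1"
proof -
  have "finite S"
    using assms(1) finite_subset by blast
  then show "0 < sum p S"
    using assms p_pos by (intro sum_pos) auto
  show "sum p S \<le> 1"
    using sum_mono2[of "{1..n}" S p] assms(1) p_pos p_sum by (auto simp: less_imp_le)
qed

lemma prob_draw_in:
  assumes t: "t \<ge> 1" and S: "S \<subseteq> {1..n}"
  shows "prob {\<omega> \<in> space M. C t \<omega> \<in> S} = sum p S"
proof -
  have fin: "finite S"
    using S finite_subset by blast
  have "{\<omega> \<in> space M. C t \<omega> \<in> S} = (\<Union>i\<in>S. {\<omega> \<in> space M. C t \<omega> = i})"
    by auto
  also have "prob \<dots> = (\<Sum>i\<in>S. prob {\<omega> \<in> space M. C t \<omega> = i})"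
    using fin sets_draw[OF t, of "{i}" for i]
    by (intro finite_measure_finite_Union) (auto simp: disjoint_family_on_def)
  also have "\<dots> = sum p S"
    using prob_draw[OF t] S by (intro sum.cong) auto
  finally show ?thesis .
qed

lemma prob_all_missing:
  assumes S: "S \<subseteq> {1..n}"
  \<comment> \<open>The case \<open>t = 0\<close> is separate: the product rule for independent
    variables needs a nonempty index set, and an intersection over no draws would be
    \<open>UNIV\<close> instead of \<open>space M\<close>.\<close>
  shows "prob {\<omega> \<in> space M. \<forall>s\<in>{1..t}. C s \<omega> \<notin> S} = (1 - sum p S) ^ t"
proof (cases "t = 0")
  case True
  then show ?thesis
    by (simp add: prob_space)
next
  case False
  then have ne: "{1..t} \<noteq> {}"
    by simp
  \<comment> \<open>The preimage form fits the independence rule, the complement form gives the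
    probability \<open>1 - sum p S\<close>.\<close>
  have vimage: "C s -` ({1..n} - S) \<inter> space M = space M - {\<omega> \<in> space M. C s \<omega> \<in> S}"
    if "s \<in> {1..t}" for s
    using that draw_in_range[of s] by auto
  have "{\<omega> \<in> space M. \<forall>s\<in>{1..t}. C s \<omega> \<notin> S} = (\<Inter>s\<in>{1..t}. C s -` ({1..n} - S) \<inter> space M)"
    using ne vimage by auto
  also have "prob \<dots> = (\<Prod>s\<in>{1..t}. prob (C s -` ({1..n} - S) \<inter> space M))"
    using ne by (intro indep_varsD[OF indep_draws]) auto
  also have "\<dots> = (\<Prod>s\<in>{1..t}. 1 - sum p S)"
  proof (rule prod.cong)
    fix s assume s: "s \<in> {1..t}"
    then show "prob (C s -` ({1..n} - S) \<inter> space M) = 1 - sum p S"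
      unfolding vimage[OF s] using S by (simp add: prob_compl sets_draw prob_draw_in)
  qed simp
  finally show ?thesis
    by simp
qed

lemma prob_less_collection_time:
  "prob {\<omega> \<in> space M. enat t < collection_time n C \<omega>} =
     (\<Sum>S | S \<subseteq> {1..n} \<and> S \<noteq> {}. (-1) ^ (card S + 1) * (1 - sum p S) ^ t)"
proof -
  define A where "A i = {\<omega> \<in> space M. \<forall>s\<in>{1..t}. C s \<omega> \<notin> {i}}" for i
  \<comment> \<open>Finite additivity of \<open>prob\<close> on disjoint events is what the abstract
    inclusion-exclusion principle asks for.\<close>
  have "Incl_Excl (\<lambda>X. X \<in> events) prob"
    by unfold_locales (auto simp: disjnt_def finite_measure_Union)
  then interpret Incl_Excl "\<lambda>X. X \<in> events" prob .
  have A: "A i \<in> events" for i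
  proof -
    have "A i = space M - (\<Union>s\<in>{1..t}. {\<omega> \<in> space M. C s \<omega> \<in> {i}})"
      by (auto simp: A_def)
    also have "\<dots> \<in> events"
      by (intro sets.Diff sets.top sets.finite_UN sets_draw) auto
    finally show ?thesis .
  qed
  have "{\<omega> \<in> space M. enat t < collection_time n C \<omega>} = \<Union> (A ` {1..n})"
    using less_collection_time_iff[where C = C, OF n_ge_1] draw_in_range by (auto simp: A_def)
  also have "prob \<dots> = (\<Sum>S | S \<subseteq> {1..n} \<and> S \<noteq> {}. (-1) ^ (card S + 1) * prob (\<Inter> (A ` S)))"
    using A by (intro restricted_indexed) auto
  also have "\<dots> = (\<Sum>S | S \<subseteq> {1..n} \<and> S \<noteq> {}. (-1) ^ (card S + 1) * (1 - sum p S) ^ t)"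
  proof (rule sum.cong)
    fix S assume S: "S \<in> {S. S \<subseteq> {1..n} \<and> S \<noteq> {}}"
    \<comment> \<open>Since \<open>S\<close> is nonempty, the intersection stays inside
      \<open>space M\<close>.\<close>
    then have "\<Inter> (A ` S) = {\<omega> \<in> space M. \<forall>s\<in>{1..t}. C s \<omega> \<notin> S}"
      by (auto simp: A_def)
    with S prob_all_missing[of S t]
    show "(-1) ^ (card S + 1) * prob (\<Inter> (A ` S)) = (-1) ^ (card S + 1) * (1 - sum p S) ^ t"
      by simp
  qed simp
  finally show ?thesis .
qed

lemma expectation_collection_time:
  "expectation_enat M (collection_time n C) =
     ereal (\<Sum>S | S \<subseteq> {1..n} \<and> S \<noteq> {}. (-1) ^ (card S - 1) * (1 / sum p S))"
  (is "_ = ereal ?E")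
proof -
  have term_sums: "(\<lambda>t. (-1) ^ (card S + 1) * (1 - sum p S) ^ t) sums
      ((-1) ^ (card S - 1) * (1 / sum p S))" if S: "S \<subseteq> {1..n}" "S \<noteq> {}" for S
  proof -
    \<comment> \<open>With \<open>card S\<close> positive, the natural subtraction in
      \<open>card S - 1\<close> does not truncate, and both exponents have the same parity.\<close>
    have "card S \<noteq> 0"
      using S finite_subset[of S "{1..n}"] by simp
    then have sign: "(-1) ^ (card S + 1) = ((-1) ^ (card S - 1) :: real)"
      by (cases "card S") auto
    have "(\<lambda>t. (1 - sum p S) ^ t) sums (1 / (1 - (1 - sum p S)))"
      using p_sum_range[OF S] by (intro geometric_sums) auto
    then show ?thesis
      unfolding sign by (intro sums_mult) simp
  qed
  \<comment> \<open>The sum over \<open>S\<close> is finite, so the series may be summed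
    termwise.\<close>
  have sums: "(\<lambda>t. prob {\<omega> \<in> space M. enat t < collection_time n C \<omega>}) sums ?E"
    unfolding prob_less_collection_time by (intro sums_sum term_sums) auto
  have "(\<integral>\<^sup>+ \<omega>. ennreal_of_enat (collection_time n C \<omega>) \<partial>M) =
      (\<Sum>t. ennreal (prob {\<omega> \<in> space M. enat t < collection_time n C \<omega>}))"
    using measurable_collection_time[OF measurable_draw]
    by (subst nn_integral_enat_function) (auto simp: emeasure_eq_measure)
  also have "\<dots> = ennreal ?E"
    using sums by (intro suminf_ennreal_eq) auto
  \<comment> \<open>As a sum of probabilities \<open>?E\<close> is nonnegative, so
    \<open>ennreal\<close> does not truncate it and the passage to \<open>ereal\<close> is
    exact.\<close>
  finally show ?thesis
    using sums_le[OF _ sums_zero sums] by (simp add: expectation_enat_def)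
qed

end

text \<open>The sign depends only on the cardinality, so it factors out of each group of subsets of
  equal size. This links the two forms of the alternating sum.\<close>

lemma sum_nonempty_subsets_by_card:
  fixes f :: "'b set \<Rightarrow> real"
  assumes "finite A"
  shows "(\<Sum>S | S \<subseteq> A \<and> S \<noteq> {}. (-1) ^ (card S - 1) * f S) =
    (\<Sum>k=1..card A. (-1) ^ (k - 1) * (\<Sum>S | S \<subseteq> A \<and> card S = k. f S))"
proof -
  have "(\<Sum>S | S \<subseteq> A \<and> S \<noteq> {}. (-1) ^ (card S - 1) * f S) =
      (\<Sum>k=1..card A. \<Sum>S | S \<in> {S. S \<subseteq> A \<and> S \<noteq> {}} \<and> card S = k. (-1) ^ (card S - 1) * f S)"
    using assms
    by (intro sum.group[symmetric])
       (auto intro: card_mono simp: Suc_le_eq card_gt_0_iff finite_subset)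
  also have "\<dots> = (\<Sum>k=1..card A. (-1) ^ (k - 1) * (\<Sum>S | S \<subseteq> A \<and> card S = k. f S))"
    unfolding sum_distrib_left by (intro sum.cong) auto
  finally show ?thesis .
qed

theorem theorem3:
  fixes M :: "'a measure" and n :: nat and p :: "nat \<Rightarrow> real" and C :: "nat \<Rightarrow> 'a \<Rightarrow> nat"
  assumes "prob_space M"
    and "n \<ge> 1"
    and "\<And>i. i \<in> {1..n} \<Longrightarrow> p i > 0"
    and "(\<Sum>i=1..n. p i) = 1"
    and "prob_space.indep_vars M (\<lambda>_. count_space {1..n}) C {1..}"
    and "\<And>t i. t \<ge> 1 \<Longrightarrow> i \<in> {1..n} \<Longrightarrow> measure M {\<omega> \<in> space M. C t \<omega> = i} = p i"
  shows "expectation_enat M (collection_time n C) =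
           ereal (\<Sum>k=1..n. (-1) ^ (k - 1) *
             (\<Sum>S | S \<subseteq> {1..n} \<and> card S = k. 1 / (\<Sum>i\<in>S. p i)))
       \<and> expectation_enat M (collection_time n C) =
           ereal (\<Sum>S | S \<subseteq> {1..n} \<and> S \<noteq> {}. (-1) ^ (card S - 1) * (1 / (\<Sum>i\<in>S. p i)))"
proof -
  interpret coupon_collector M n p C
    by (intro coupon_collector.intro coupon_collector_axioms.intro assms)
  show ?thesis
    using expectation_collection_time
      sum_nonempty_subsets_by_card[of "{1..n}" "\<lambda>S. 1 / sum p S"]
    by simp
qed

end
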